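(* Let $G$ be a finite Abelian group, $H\subset G$ a subgroup such that $G/H$ is cyclic, and $\rho\in G$ an element whose image in $G/H$ is a generator. The image of the monoscopic embedding $\Phi_\rho:\mathcal{C}(H)\to\mathcal{C}(G)$ is a face of $\mathcal{C}(G)$. More precisely, given any face $F\subset\mathcal{C}(H)$ with Kunz poset $P=(H/H',\preceq)$ (where $H'$ is the Kunz subgroup of $F$), the image $\Phi_\rho(F)$ is a face of $\mathcal{C}(G)$ whose Kunz poset is the augmented monoscopic extension of $P$ along $\rho$.
   Context: Group cone: for a finite Abelian group $G$ with $|G|=m$, the group cone $\mathcal{C}(G)\subset\mathbb{R}^{m-1}_{\ge 0}$ (coordinates indexed by $G\setminus\{0\}$) is the pointed cone of all points with non-negative coordinates satisfying $x_i+x_j\ge x_{i+j}$ for all $i,j\in G\setminus\{0\}$ with $i+j\ne 0$. (Non-negativity is implied by the other inequalities when $|G|\ge 3$.) By convention each point of $\mathcal{C}(G)$ is also given a coordinate $x_0=0$ indexed by the identity. Kunz subgroup and Kunz poset: for a face $F\subset\mathcal{C}(G)$, the set $K=\{g\in G: x_g=0\text{ for all }x\in F\}$ is a subgroup of $G$, called the Kunz subgroup of $F$; the Kunz poset of $F$ is the partial order on $G/K$ with unique minimal element $\overline 0$ and $\overline a\preceq\overline b$ whenever $x_a+x_{b-a}=x_b$ for all $x\in F$ ($a,b\in G$ distinct). This is known to be well defined. Monoscopic embedding: let $\beta=|G/H|$. Define $\Phi_\rho:\mathcal{C}(H)\to\mathcal{C}(G)$, $w\mapsto x$, by $x_{a+b\rho}=\beta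 w_a+b\,w_{\beta\rho}$ for each $a\in H$ and each integer $0\le b<\beta$ (here $\beta\rho\in H$, and $w_0=0$). Augmented monoscopic extension: let $P=(H/H',\preceq_P)$ be a poset, with $H'\subset H$ a subgroup. Every element of $G/H'$ is uniquely $a+b\rho$ with $a\in H/H'$, $0\le b\le\beta-1$. The augmented monoscopic extension of $P$ along $\rho$ is: (i) if $\beta\rho\ne 0$ in $H/H'$, the poset $Q=(G/H',\preceq_Q)$ with $a+b\rho\preceq_Q a'+b'\rho$ (for $a,a'\in H/H'$, $0\le b,b'\le\beta-1$) exactly when $a\preceq_P a'$ and either $b\le b'$ or $\beta\rho\preceq_P a'-a$; (ii) if $\beta\rho=0$ in $H/H'$, the poset on $G/(H'+\langle\rho\rangle)$ identical to $P$ under the natural isomorphism $G/(H'+\langle\rho\rangle)\cong H/H'$. *)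

theory Defs
  imports "HOL-Analysis.Analysis" "HOL-Algebra.Elementary_Groups"
begin

text \<open>
  Finite Abelian groups are \<open>comm_group\<close>s (written multiplicatively) whose carrier lies in a
  finite type \<open>'a\<close>.  The space of real vectors indexed by \<open>G - {0}\<close> is the coordinate subspace
  of \<open>real ^ 'a\<close> of vectors vanishing at the identity (the convention \<open>x\<^sub>0 = 0\<close>) and outside
  the carrier.  For a subgroup \<open>H\<close> of \<open>G\<close>, the cone of \<open>H\<close> is the cone of the group
  \<open>G\<lparr>carrier := H\<rparr>\<close>.
\<close>

definition group_cone :: "('a::finite, 'm) monoid_scheme \<Rightarrow> (real ^ 'a) set" where
  "group_cone G = {x. (\<forall>i. i \<notin> carrier G - {\<one>\<^bsub>G\<^esub>} \<longrightarrow> x $ i = 0) \<and>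
     (\<forall>i \<in> carrier G - {\<one>\<^bsub>G\<^esub>}. 0 \<le> x $ i) \<and>
     (\<forall>i \<in> carrier G - {\<one>\<^bsub>G\<^esub>}. \<forall>j \<in> carrier G - {\<one>\<^bsub>G\<^esub>}.
        i \<otimes>\<^bsub>G\<^esub> j \<noteq> \<one>\<^bsub>G\<^esub> \<longrightarrow> x $ (i \<otimes>\<^bsub>G\<^esub> j) \<le> x $ i + x $ j)}"

definition kunz_subgroup :: "('a::finite, 'm) monoid_scheme \<Rightarrow> (real ^ 'a) set \<Rightarrow> 'a set" where
  "kunz_subgroup G F = {g \<in> carrier G. \<forall>x \<in> F. x $ g = 0}"

text \<open>
  A poset is a pair of its ground set and its (reflexive) order relation.  The defining condition
  of the Kunz poset does not depend on the representatives \<open>a\<close>, \<open>b\<close> of the cosets, and it holds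
  for \<open>a = b\<close> because \<open>x\<^sub>0 = 0\<close>, so reflexivity needs no separate clause.
\<close>

definition kunz_poset ::
  "('a::finite, 'm) monoid_scheme \<Rightarrow> (real ^ 'a) set \<Rightarrow> 'a set set \<times> 'a set rel" where
  "kunz_poset G F = (let K = kunz_subgroup G F in
     (carrier (G Mod K),
      {(K #>\<^bsub>G\<^esub> a, K #>\<^bsub>G\<^esub> b) | a b. a \<in> carrier G \<and> b \<in> carrier G \<and>
         (\<forall>x \<in> F. x $ a + x $ (b \<otimes>\<^bsub>G\<^esub> inv\<^bsub>G\<^esub> a) = x $ b)}))"

text \<open>
  The description is unique when the coset of \<open>\<rho>\<close> generates \<open>G Mod H\<close>: every \<open>g\<close> in \<open>G\<close> is
  \<open>a + b\<rho>\<close> for exactly one \<open>a\<close> in \<open>H\<close> and one \<open>b < \<beta>\<close>, where \<open>\<beta> = |G/H|\<close>.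
\<close>

definition monoscopic_embedding ::
  "('a::finite, 'm) monoid_scheme \<Rightarrow> 'a set \<Rightarrow> 'a \<Rightarrow> real ^ 'a \<Rightarrow> real ^ 'a" where
  "monoscopic_embedding G H \<rho> w = (let \<beta> = order (G Mod H) in
     (\<chi> g. if g \<in> carrier G
           then THE y. \<exists>a \<in> H. \<exists>b < \<beta>. g = a \<otimes>\<^bsub>G\<^esub> \<rho> [^]\<^bsub>G\<^esub> b \<and>
                  y = real \<beta> * w $ a + real b * w $ (\<rho> [^]\<^bsub>G\<^esub> \<beta>)
           else 0))"

text \<open>
  \<open>P\<close> is a poset on \<open>H/H'\<close>.  As \<open>H' \<subseteq> H\<close>, the cosets of \<open>H'\<close> in \<open>H\<close> are literally cosets
  of \<open>H'\<close> in \<open>G\<close>, so \<open>a + b\<rho>\<close> with \<open>a\<close> in \<open>H/H'\<close> is formed in \<open>G Mod H'\<close>.  In the second case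
  \<open>N = H' + \<langle>\<rho>\<rangle>\<close>, and \<open>A \<mapsto> N <#> A\<close> is the natural isomorphism from \<open>H/H'\<close> to \<open>G/N\<close>.
\<close>

definition augmented_monoscopic_extension ::
  "('a, 'm) monoid_scheme \<Rightarrow> 'a set \<Rightarrow> 'a set \<Rightarrow> 'a \<Rightarrow>
   'a set set \<times> 'a set rel \<Rightarrow> 'a set set \<times> 'a set rel" where
  "augmented_monoscopic_extension G H H' \<rho> P =
    (let \<beta> = order (G Mod H); GH' = G Mod H'; HH' = (G\<lparr>carrier := H\<rparr>) Mod H';
         r = H' #>\<^bsub>G\<^esub> \<rho>; N = H' <#>\<^bsub>G\<^esub> generate G {\<rho>}
     in if r [^]\<^bsub>GH'\<^esub> \<beta> \<noteq> \<one>\<^bsub>HH'\<^esub>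
        then (carrier GH',
              {(A \<otimes>\<^bsub>GH'\<^esub> r [^]\<^bsub>GH'\<^esub> b, A' \<otimes>\<^bsub>GH'\<^esub> r [^]\<^bsub>GH'\<^esub> b') | A A' b b'.
                 A \<in> carrier HH' \<and> A' \<in> carrier HH' \<and> b < \<beta> \<and> b' < \<beta> \<and>
                 (A, A') \<in> snd P \<and>
                 (b \<le> b' \<or> (r [^]\<^bsub>GH'\<^esub> \<beta>, A' \<otimes>\<^bsub>HH'\<^esub> inv\<^bsub>HH'\<^esub> A) \<in> snd P)})
        else (carrier (G Mod N),
              {(N <#>\<^bsub>G\<^esub> A, N <#>\<^bsub>G\<^esub> A') | A A'. (A, A') \<in> snd P}))"

end

theory Submission
  imports Defs "HOL-Algebra.Multiplicative_Group"
begin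

text \<open>
  Let \<open>w\<close> be a point of the cone of \<open>H\<close> and \<open>x\<close> its image.  Besides membership in the cone of \<open>G\<close>,
  the image is cut out by \<open>x\<^sub>a + b x\<^sub>\<rho> = x\<^bsub>a+b\<rho>\<^esub>\<close> for \<open>b < \<beta>\<close> and \<open>\<beta> x\<^sub>\<rho> = x\<^bsub>\<beta>\<rho>\<^esub>\<close>.  On the whole cone of \<open>G\<close>
  these hold as inequalities, so a segment that meets the image in its interior stays in it.  The
  embedding is inverted there by \<open>x \<mapsto> (x\<^sub>a / \<beta>)\<^sub>a\<close>, which pulls such a segment back to the cone of
  \<open>H\<close>; hence faces go to faces.  For the poset, subtract \<open>a + b\<rho>\<close> from \<open>a' + b'\<rho>\<close>: if \<open>b \<le> b'\<close>,
  tightness says \<open>w\<^sub>a + w\<^bsub>a'-a\<^esub> = w\<^bsub>a'\<^esub>\<close>, and otherwise \<open>\<beta>\<rho>\<close> is borrowed and it says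
  \<open>w\<^sub>a + w\<^bsub>\<beta>\<rho>\<^esub> + w\<^bsub>a'-a-\<beta>\<rho>\<^esub> = w\<^bsub>a'\<^esub>\<close>, which splits into two tight triangle inequalities.
\<close>

text \<open>Serves to subtract \<open>a + b\<rho>\<close> from \<open>a' + b'\<rho>\<close>:
  \<open>v\<close> is the power of \<open>\<rho>\<close> shared by both elements and
  \<open>u\<close> is what the second has beyond it.\<close>

lemma (in comm_group) mult_inv_cancel_right:
  assumes "x \<in> carrier G" "a \<in> carrier G" "u \<in> carrier G" "v \<in> carrier G"
  shows "x \<otimes> (u \<otimes> v) \<otimes> inv (a \<otimes> v) = x \<otimes> inv a \<otimes> u"
proof -
  have "v \<otimes> (inv v \<otimes> (inv a \<otimes> u)) = inv a \<otimes> u"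
    using assms by (simp flip: m_assoc)
  then show ?thesis using assms by (simp add: inv_mult_group m_assoc m_comm[of u])
qed

lemma (in comm_group) mult_inv_cancel:
  assumes "x \<in> carrier G" "v \<in> carrier G"
  shows "v \<otimes> (x \<otimes> inv v) = x"
  using assms by (simp add: m_comm[of v] m_assoc)

section \<open>Group cones, Kunz subgroups and Kunz posets\<close>

lemma group_coneD:
  assumes "x \<in> group_cone G"
  shows "i \<notin> carrier G \<Longrightarrow> x $ i = 0" and "x $ \<one>\<^bsub>G\<^esub> = 0"
    and "0 \<le> x $ i"
  using assms by (auto simp: group_cone_def)

locale cone_group = comm_group G for G :: "('a::finite, 'm) monoid_scheme" (structure)
begin

text \<open>The cases left out of the definition hold because \<open>x $ \<one> = 0\<close>: a
  trivial summand gives equality, and \<open>i \<otimes> j = \<one>\<close> reduces to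
  non-negativity. Later arguments can therefore ignore the identity.\<close>

lemma group_cone_triangle:
  assumes x: "x \<in> group_cone G" and ij: "i \<in> carrier G" "j \<in> carrier G"
  shows "x $ (i \<otimes> j) \<le> x $ i + x $ j"
proof (cases "i = \<one> \<or> j = \<one> \<or> i \<otimes> j = \<one>")
  case True
  then show ?thesis
    using group_coneD(2,3)[OF x] ij by auto
next
  case False
  then show ?thesis
    using x ij by (auto simp: group_cone_def)
qed

lemma group_coneI:
  assumes "\<And>i. i \<notin> carrier G \<Longrightarrow> x $ i = 0" and "x $ \<one> = 0"
    and "\<And>i. i \<in> carrier G \<Longrightarrow> 0 \<le> x $ i"
    and "\<And>i j. i \<in> carrier G \<Longrightarrow> j \<in> carrier G \<Longrightarrow> x $ (i \<otimes> j) \<le> x $ i + x $ j"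
  shows "x \<in> group_cone G"
  using assms by (auto simp: group_cone_def)

text \<open>Makes the cone a face of itself, so that the claim about the whole image becomes an
  instance of the claim about faces.\<close>

lemma convex_group_cone: "convex (group_cone G)"
proof (rule convexI)
  fix x y :: "real ^ 'a" and u v :: real
  assume x: "x \<in> group_cone G" and y: "y \<in> group_cone G" and uv: "0 \<le> u" "0 \<le> v"
  show "u *\<^sub>R x + v *\<^sub>R y \<in> group_cone G"
  proof (rule group_coneI)
    fix i j assume ij: "i \<in> carrier G" "j \<in> carrier G"
    have "u * x $ (i \<otimes> j) \<le> u * (x $ i + x $ j)" "v * y $ (i \<otimes> j) \<le> v * (y $ i + y $ j)"
      using group_cone_triangle[OF x ij] group_cone_triangle[OF y ij] uv
      by (auto intro: mult_left_mono)
    then show "(u *\<^sub>R x + v *\<^sub>R y) $ (i \<otimes> j) \<le> (u *\<^sub>R x + v *\<^sub>R y) $ i + (u *\<^sub>R x + v *\<^sub>R y) $ j"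
      by (simp add: algebra_simps)
  qed (use group_coneD[OF x] group_coneD[OF y] uv in auto)
qed

lemma group_cone_pow:
  assumes x: "x \<in> group_cone G" and a: "a \<in> carrier G"
  shows "x $ (a [^] (n::nat)) \<le> real n * x $ a"
proof (induction n)
  case 0
  then show ?case using group_coneD(2)[OF x] by simp
next
  case (Suc n)
  then show ?case
    using group_cone_triangle[OF x _ a, of "a [^] n"] a by (simp add: algebra_simps)
qed

lemma subgroup_kunz_subgroup:
  assumes F: "F \<subseteq> group_cone G"
  shows "subgroup (kunz_subgroup G F) G"
proof
  fix a assume a: "a \<in> kunz_subgroup G F"
  then have aG: "a \<in> carrier G" by (simp add: kunz_subgroup_def)
  \<comment> \<open>In a finite group \<open>inv a\<close> is a natural power of \<open>a\<close>,
    so the iterated triangle inequality bounds \<open>x $ (inv a)\<close> by a multiple of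
    \<open>x $ a = 0\<close>.\<close>
  have "order G > 0" by (simp add: order_gt_0_iff_finite)
  then obtain n where n: "order G = Suc n" by (metis gr0_implies_Suc)
  have "a [^] n \<otimes> a = \<one>"
    using pow_order_eq_1[OF aG] n by simp
  then have inv: "inv a = a [^] n"
    using aG by (simp add: inv_equality)
  have "x $ (inv a) = 0" if "x \<in> F" for x
  proof (rule antisym)
    have "x $ a = 0" using a that by (simp add: kunz_subgroup_def)
    then show "x $ (inv a) \<le> 0"
      using group_cone_pow[of x a n] that F aG inv by auto
  qed (use that F group_coneD(3) in blast)
  then show "inv a \<in> kunz_subgroup G F"
    using aG by (simp add: kunz_subgroup_def)
next
  fix a b assume ab: "a \<in> kunz_subgroup G F" "b \<in> kunz_subgroup G F"
  have "x $ (a \<otimes> b) = 0" if "x \<in> F" for x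
  proof (rule antisym)
    show "x $ (a \<otimes> b) \<le> 0"
      using group_cone_triangle[of x a b] that F ab by (auto simp: kunz_subgroup_def)
  qed (use that F group_coneD(3) in blast)
  then show "a \<otimes> b \<in> kunz_subgroup G F"
    using ab by (simp add: kunz_subgroup_def)
qed (use F group_coneD(2) in \<open>auto simp: kunz_subgroup_def\<close>)

text \<open>Both \<open>k\<close> and \<open>inv k\<close> have coordinate zero, so the triangle
  inequality bounds each side by the other.\<close>

lemma kunz_subgroup_translate:
  assumes F: "F \<subseteq> group_cone G" and x: "x \<in> F" and k: "k \<in> kunz_subgroup G F"
    and a: "a \<in> carrier G"
  shows "x $ (k \<otimes> a) = x $ a"
proof (rule antisym)
  interpret K: subgroup "kunz_subgroup G F" G by (rule subgroup_kunz_subgroup[OF F])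
  have kG: "k \<in> carrier G" and k0: "x $ k = 0" "x $ (inv k) = 0"
    using k K.m_inv_closed[OF k] x unfolding kunz_subgroup_def by blast+
  have xc: "x \<in> group_cone G" using x F by blast
  show "x $ (k \<otimes> a) \<le> x $ a"
    using group_cone_triangle[OF xc kG a] k0 by simp
  have "inv k \<otimes> (k \<otimes> a) = a" using kG a by (simp flip: m_assoc)
  then show "x $ a \<le> x $ (k \<otimes> a)"
    using group_cone_triangle[OF xc, of "inv k" "k \<otimes> a"] k0 kG a by simp
qed

text \<open>The definition only asks for some representatives of the two cosets; here the condition
  is shown to be independent of that choice, so it can be tested on given ones.\<close>

lemma kunz_poset_iff:
  assumes F: "F \<subseteq> group_cone G" and ab: "a \<in> carrier G" "b \<in> carrier G"
  shows "(kunz_subgroup G F #> a, kunz_subgroup G F #> b) \<in> snd (kunz_poset G F)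
    \<longleftrightarrow> (\<forall>x\<in>F. x $ a + x $ (b \<otimes> inv a) = x $ b)" (is "?L \<longleftrightarrow> ?R")
proof
  assume ?R
  then show ?L using ab by (auto simp: kunz_poset_def Let_def)
next
  assume ?L
  interpret K: subgroup "kunz_subgroup G F" G by (rule subgroup_kunz_subgroup[OF F])
  obtain c d where cd: "c \<in> carrier G" "d \<in> carrier G"
    and eq: "kunz_subgroup G F #> a = kunz_subgroup G F #> c"
      "kunz_subgroup G F #> b = kunz_subgroup G F #> d"
    and le: "\<And>x. x \<in> F \<Longrightarrow> x $ c + x $ (d \<otimes> inv c) = x $ d"
    using \<open>?L\<close> by (auto simp: kunz_poset_def Let_def)
  obtain k where k: "k \<in> kunz_subgroup G F" "a = k \<otimes> c"
    using rcos_self[OF ab(1) K.subgroup_axioms] eq by (auto simp: r_coset_def)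
  obtain l where l: "l \<in> kunz_subgroup G F" "b = l \<otimes> d"
    using rcos_self[OF ab(2) K.subgroup_axioms] eq by (auto simp: r_coset_def)
  have kl: "k \<in> carrier G" "l \<in> carrier G" using k l K.subset by auto
  \<comment> \<open>Changing representatives alters the difference by an element of the Kunz
    subgroup too, so all three coordinates in the condition keep their values.\<close>
  have "b \<otimes> inv a = (l \<otimes> inv k) \<otimes> (d \<otimes> inv c)"
    using k l kl cd by (simp add: inv_mult m_ac)
  moreover have "l \<otimes> inv k \<in> kunz_subgroup G F" using k l by simp
  ultimately show ?R
    using kunz_subgroup_translate[OF F] le k l cd by simp
qed

end

lemma fst_kunz_poset: "fst (kunz_poset G F) = carrier (G Mod kunz_subgroup G F)"
  by (simp add: kunz_poset_def Let_def)

lemma kunz_poset_cases: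
  assumes "p \<in> snd (kunz_poset G F)"
  obtains a b where "a \<in> carrier G" "b \<in> carrier G"
    "p = (kunz_subgroup G F #>\<^bsub>G\<^esub> a, kunz_subgroup G F #>\<^bsub>G\<^esub> b)"
  using assms by (auto simp: kunz_poset_def Let_def)

section \<open>Decomposition of the group along \<open>\<rho>\<close>\<close>

locale monoscopic = cone_group G for G :: "('a::finite, 'm) monoid_scheme" (structure) +
  fixes H :: "'a set" and \<rho> :: 'a
  assumes subgroup_H: "subgroup H G" and rho: "\<rho> \<in> carrier G"
    and generates: "generate (G Mod H) {H #> \<rho>} = carrier (G Mod H)"
begin

abbreviation \<beta> :: nat where "\<beta> \<equiv> order (G Mod H)"
abbreviation GH where "GH \<equiv> G\<lparr>carrier := H\<rparr>"
abbreviation \<Phi> :: "real ^ 'a \<Rightarrow> real ^ 'a" where "\<Phi> \<equiv> monoscopic_embedding G H \<rho>"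

sublocale H: normal H G
  by (rule subgroup_imp_normal[OF subgroup_H])

sublocale GH: cone_group GH
  unfolding cone_group_def
  by (rule group.group_comm_groupI[OF subgroup.subgroup_is_group[OF subgroup_H is_group]])
    (auto intro: m_comm)

sublocale Q: group "G Mod H"
  by (rule H.factorgroup_is_group)

lemma ord_rho: "Q.ord (H #> \<rho>) = \<beta>"
proof -
  have "H #> \<rho> \<in> carrier (G Mod H)" using rho by (auto simp: carrier_FactGroup)
  then show ?thesis
    using Q.generate_pow_card generates by (simp add: order_def)
qed

lemma beta_pos: "\<beta> > 0"
  by (simp add: Q.order_gt_0_iff_finite)

lemma rho_pow_mem_iff: "\<rho> [^] (n::nat) \<in> H \<longleftrightarrow> \<beta> dvd n"
proof -
  have "\<rho> [^] n \<in> H \<longleftrightarrow> H #> \<rho> [^] n = H"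
    using coset_join1 coset_join2 rho subgroup_H H.subset by (metis nat_pow_closed)
  also have "\<dots> \<longleftrightarrow> (H #> \<rho>) [^]\<^bsub>G Mod H\<^esub> n = \<one>\<^bsub>G Mod H\<^esub>"
    using H.FactGroup_pow[OF rho] by simp
  also have "\<dots> \<longleftrightarrow> \<beta> dvd n"
    using Q.pow_eq_id[of "H #> \<rho>" n] ord_rho rho by (auto simp: carrier_FactGroup)
  finally show ?thesis .
qed

lemma decompose:
  assumes g: "g \<in> carrier G"
  obtains a b where "a \<in> H" "b < \<beta>" "g = a \<otimes> \<rho> [^] b"
proof -
  have rQ: "H #> \<rho> \<in> carrier (G Mod H)" using rho by (auto simp: carrier_FactGroup)
  have "H #> g \<in> generate (G Mod H) {H #> \<rho>}" using g generates by (auto simp: carrier_FactGroup)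
  then obtain n :: nat where "H #> g = (H #> \<rho>) [^]\<^bsub>G Mod H\<^esub> n"
    using Q.generate_pow_nat[OF rQ] ord_rho beta_pos by auto
  also have "\<dots> = H #> \<rho> [^] n" by (rule H.FactGroup_pow[OF rho])
  finally have "g \<in> H #> \<rho> [^] n" using rcos_self[OF g subgroup_H] by simp
  then obtain h where h: "h \<in> H" "g = h \<otimes> \<rho> [^] n" by (auto simp: r_coset_def)
  \<comment> \<open>The exponent is reduced modulo \<open>\<beta>\<close>; the discarded multiple of
    \<open>\<beta>\<rho>\<close> lies in \<open>H\<close> and is absorbed into the
    \<open>H\<close>-part.\<close>
  have "\<rho> [^] n = \<rho> [^] (\<beta> * (n div \<beta>)) \<otimes> \<rho> [^] (n mod \<beta>)"
    using rho by (simp add: nat_pow_mult)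
  then have "g = (h \<otimes> \<rho> [^] (\<beta> * (n div \<beta>))) \<otimes> \<rho> [^] (n mod \<beta>)"
    using h rho by (simp add: m_assoc)
  moreover have "h \<otimes> \<rho> [^] (\<beta> * (n div \<beta>)) \<in> H"
    using h rho_pow_mem_iff by simp
  ultimately show thesis
    using that[of _ "n mod \<beta>"] beta_pos by simp
qed

lemma decompose_unique:
  assumes "a \<in> H" "a' \<in> H" "b < \<beta>" "b' < \<beta>" "a \<otimes> \<rho> [^] b = a' \<otimes> \<rho> [^] b'"
  shows "a = a'" "b = b'"
proof -
  \<comment> \<open>Stated for arbitrary decompositions so that it can be applied in both
    directions. If \<open>b < b'\<close>, then \<open>\<rho> [^] (b' - b)\<close> would lie in
    \<open>H\<close> although \<open>0 < b' - b < \<beta>\<close>.\<close>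
  have *: "b' \<le> b" if "a \<in> H" "a' \<in> H" "b < \<beta>" "b' < \<beta>" "a \<otimes> \<rho> [^] b = a' \<otimes> \<rho> [^] b'" for a a' b b'
  proof (rule ccontr)
    assume "\<not> b' \<le> b"
    then have b': "\<rho> [^] b' = \<rho> [^] (b' - b) \<otimes> \<rho> [^] b"
      using rho by (simp add: nat_pow_mult)
    have "a = a' \<otimes> \<rho> [^] (b' - b)"
      using that b' rho by (simp flip: m_assoc)
    then have "\<rho> [^] (b' - b) = inv a' \<otimes> a"
      using that rho by (simp flip: m_assoc)
    moreover have "inv a' \<otimes> a \<in> H"
      using that by simp
    ultimately have "\<beta> dvd b' - b"
      using rho_pow_mem_iff by metis
    then show False using \<open>\<not> b' \<le> b\<close> that(4) by (auto dest: dvd_imp_le)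
  qed
  show b: "b = b'"
    using *[OF assms] *[OF assms(2,1,4,3) assms(5)[symmetric]] by simp
  show "a = a'" using assms b rho by simp
qed

section \<open>The embedding as a linear map between the cones\<close>

lemma embedding_nth:
  assumes "a \<in> H" "b < \<beta>"
  shows "\<Phi> w $ (a \<otimes> \<rho> [^] b) = real \<beta> * w $ a + real b * w $ (\<rho> [^] \<beta>)"
proof -
  \<comment> \<open>Uniqueness of the decomposition evaluates the description operator; all values
    of the embedding on the carrier are derived from this formula.\<close>
  have "(THE y. \<exists>a'\<in>H. \<exists>b'<\<beta>. a \<otimes> \<rho> [^] b = a' \<otimes> \<rho> [^] b' \<and>
      y = real \<beta> * w $ a' + real b' * w $ (\<rho> [^] \<beta>))
    = real \<beta> * w $ a + real b * w $ (\<rho> [^] \<beta>)"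
  proof (rule the_equality)
    fix y
    assume "\<exists>a'\<in>H. \<exists>b'<\<beta>. a \<otimes> \<rho> [^] b = a' \<otimes> \<rho> [^] b' \<and>
      y = real \<beta> * w $ a' + real b' * w $ (\<rho> [^] \<beta>)"
    then obtain a' b' where ab': "a' \<in> H" "b' < \<beta>" "a \<otimes> \<rho> [^] b = a' \<otimes> \<rho> [^] b'"
      and y: "y = real \<beta> * w $ a' + real b' * w $ (\<rho> [^] \<beta>)"
      by blast
    show "y = real \<beta> * w $ a + real b * w $ (\<rho> [^] \<beta>)"
      using decompose_unique[OF assms(1) ab'(1) assms(2) ab'(2,3)] y by simp
  qed (use assms in blast)
  then show ?thesis
    using assms rho by (simp add: monoscopic_embedding_def Let_def)
qed

lemma embedding_nth_H: "a \<in> H \<Longrightarrow> \<Phi> w $ a = real \<beta> * w $ a"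
  using embedding_nth[of a 0 w] beta_pos by simp

lemma embedding_nth_outside: "g \<notin> carrier G \<Longrightarrow> \<Phi> w $ g = 0"
  by (simp add: monoscopic_embedding_def Let_def)

lemma rho_beta_mem: "\<rho> [^] \<beta> \<in> H"
  by (simp add: rho_pow_mem_iff)

lemma linear_embedding: "linear \<Phi>"
proof (rule linearI; rule vec_eq_iff[THEN iffD2]; rule allI)
  fix v w :: "real ^ 'a" and c :: real and g
  show "\<Phi> (v + w) $ g = (\<Phi> v + \<Phi> w) $ g"
  proof (cases "g \<in> carrier G")
    case True
    then obtain a b where "a \<in> H" "b < \<beta>" "g = a \<otimes> \<rho> [^] b" by (rule decompose)
    then show ?thesis by (simp add: embedding_nth algebra_simps)
  qed (simp add: embedding_nth_outside)
  show "\<Phi> (c *\<^sub>R w) $ g = (c *\<^sub>R \<Phi> w) $ g"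
  proof (cases "g \<in> carrier G")
    case True
    then obtain a b where "a \<in> H" "b < \<beta>" "g = a \<otimes> \<rho> [^] b" by (rule decompose)
    then show ?thesis by (simp add: embedding_nth algebra_simps)
  qed (simp add: embedding_nth_outside)
qed

text \<open>Addition with carry: two exponents below \<open>\<beta>\<close> have a sum below
  \<open>2 * \<beta>\<close>, so at most one \<open>\<beta>\<rho>\<close> has to move into the
  \<open>H\<close>-part.\<close>

lemma embedding_nth_carry:
  assumes "a \<in> H" "b \<ge> \<beta>" "b < 2 * \<beta>"
  shows "\<Phi> w $ (a \<otimes> \<rho> [^] b)
    = real \<beta> * w $ (a \<otimes> \<rho> [^] \<beta>) + real (b - \<beta>) * w $ (\<rho> [^] \<beta>)"
proof -
  have "\<rho> [^] b = \<rho> [^] \<beta> \<otimes> \<rho> [^] (b - \<beta>)" using assms rho by (simp add: nat_pow_mult)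
  then have "a \<otimes> \<rho> [^] b = (a \<otimes> \<rho> [^] \<beta>) \<otimes> \<rho> [^] (b - \<beta>)"
    using assms rho by (simp add: m_assoc)
  then show ?thesis
    using embedding_nth[of "a \<otimes> \<rho> [^] \<beta>" "b - \<beta>" w] assms rho_beta_mem by simp
qed

lemma embedding_in_cone:
  assumes w: "w \<in> group_cone GH"
  shows "\<Phi> w \<in> group_cone G"
proof (rule group_coneI)
  have nn: "0 \<le> w $ i" for i using group_coneD(3)[OF w] .
  have tri: "w $ (i \<otimes> j) \<le> w $ i + w $ j" if "i \<in> H" "j \<in> H" for i j
    using GH.group_cone_triangle[OF w, of i j] that by simp
  show "\<Phi> w $ \<one> = 0" using embedding_nth_H[of \<one> w] group_coneD(2)[OF w] by simp
  fix i assume i: "i \<in> carrier G"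
  obtain a b where ab: "a \<in> H" "b < \<beta>" "i = a \<otimes> \<rho> [^] b" using decompose[OF i] .
  show "0 \<le> \<Phi> w $ i" using ab by (simp add: embedding_nth nn)
  fix j assume j: "j \<in> carrier G"
  obtain c d where cd: "c \<in> H" "d < \<beta>" "j = c \<otimes> \<rho> [^] d" using decompose[OF j] .
  have ij: "i \<otimes> j = (a \<otimes> c) \<otimes> \<rho> [^] (b + d)"
    using ab cd rho by (simp add: m_ac flip: nat_pow_mult)
  have sum: "\<Phi> w $ i + \<Phi> w $ j = real \<beta> * (w $ a + w $ c) + real (b + d) * w $ (\<rho> [^] \<beta>)"
    using ab cd by (simp add: embedding_nth algebra_simps)
  show "\<Phi> w $ (i \<otimes> j) \<le> \<Phi> w $ i + \<Phi> w $ j"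
  proof (cases "b + d < \<beta>")
    case True
    then show ?thesis
      unfolding sum ij using embedding_nth[of "a \<otimes> c" "b + d" w] tri[of a c] ab cd
      by (simp add: mult_left_mono)
  next
    case False
    \<comment> \<open>The carry adds \<open>\<beta>\<rho>\<close> to the \<open>H\<close>-part,
      which costs at most \<open>\<beta> * w $ (\<rho> [^] \<beta>)\<close>. The linear term shrinks
      by exactly this amount.\<close>
    have "w $ (a \<otimes> c \<otimes> \<rho> [^] \<beta>) \<le> w $ a + w $ c + w $ (\<rho> [^] \<beta>)"
      using tri[of "a \<otimes> c" "\<rho> [^] \<beta>"] tri[of a c] ab cd rho_beta_mem by simp
    then have "real \<beta> * w $ (a \<otimes> c \<otimes> \<rho> [^] \<beta>) \<le> real \<beta> * (w $ a + w $ c + w $ (\<rho> [^] \<beta>))"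
      by (rule mult_left_mono) simp
    moreover have "\<Phi> w $ (i \<otimes> j) = real \<beta> * w $ (a \<otimes> c \<otimes> \<rho> [^] \<beta>)
        + (real b + real d - real \<beta>) * w $ (\<rho> [^] \<beta>)"
      unfolding ij using embedding_nth_carry[of "a \<otimes> c" "b + d" w] ab cd False
      by (simp add: of_nat_diff)
    ultimately show ?thesis
      unfolding sum by (simp add: algebra_simps)
  qed
qed (rule embedding_nth_outside)

section \<open>Images of faces are faces\<close>

definition \<Psi> :: "real ^ 'a \<Rightarrow> real ^ 'a" where
  "\<Psi> x = (\<chi> a. if a \<in> H then x $ a / real \<beta> else 0)"

lemma linear_restriction: "linear \<Psi>"
  by (rule linearI) (auto simp: \<Psi>_def vec_eq_iff add_divide_distrib)

text \<open>On \<open>H\<close> the embedding is multiplication by \<open>\<beta>\<close>; off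
  \<open>H\<close> the default value zero of \<open>\<Psi>\<close> agrees with the convention for
  points of the cone of \<open>H\<close>.\<close>

lemma restriction_embedding:
  assumes "w \<in> group_cone GH"
  shows "\<Psi> (\<Phi> w) = w"
  using group_coneD(1)[OF assms] beta_pos by (auto simp: \<Psi>_def vec_eq_iff embedding_nth_H)

lemma restriction_in_cone:
  assumes x: "x \<in> group_cone G"
  shows "\<Psi> x \<in> group_cone GH"
proof (rule GH.group_coneI)
  fix i j assume "i \<in> carrier GH" "j \<in> carrier GH"
  then show "\<Psi> x $ (i \<otimes>\<^bsub>GH\<^esub> j) \<le> \<Psi> x $ i + \<Psi> x $ j"
    using group_cone_triangle[OF x, of i j]
    by (simp add: \<Psi>_def divide_right_mono flip: add_divide_distrib)
qed (use group_coneD[OF x] in \<open>auto simp: \<Psi>_def\<close>)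

text \<open>The gap in an inequality valid on the cone of \<open>G\<close>. As a linear functional
  that is non-negative there, it can vanish inside a segment only if it vanishes at both
  ends.\<close>

definition slack :: "'a \<Rightarrow> nat \<Rightarrow> real ^ 'a \<Rightarrow> real" where
  "slack a b x = x $ a + real b * x $ \<rho> - x $ (a \<otimes> \<rho> [^] b)"

lemma slack_nonneg:
  assumes x: "x \<in> group_cone G" and a: "a \<in> H"
  shows "0 \<le> slack a b x"
  using group_cone_triangle[OF x, of a "\<rho> [^] b"] group_cone_pow[OF x rho, of b] a rho
  by (simp add: slack_def)

text \<open>
  At \<open>b = \<beta>\<close> the slack vanishes for \<open>a = \<one>\<close> only: for other \<open>a\<close> the sum \<open>a + \<beta>\<rho>\<close> lies in \<open>H\<close> again
  and the triangle inequality of \<open>w\<close> may be strict.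
\<close>
lemma slack_embedding:
  assumes "w \<in> group_cone GH" "a \<in> H" "b < \<beta> \<or> a = \<one> \<and> b = \<beta>"
  shows "slack a b (\<Phi> w) = 0"
proof -
  have w1: "w $ \<one> = 0" using group_coneD(2)[OF assms(1)] by simp
  have r: "\<Phi> w $ \<rho> = w $ (\<rho> [^] \<beta>)"
  \<comment> \<open>For \<open>\<beta> = 1\<close> the exponent 1 is not below
    \<open>\<beta>\<close>: then \<open>\<rho>\<close> lies in \<open>H\<close> and is its own
    \<open>H\<close>-part.\<close>
  proof (cases "\<beta> = 1")
    case True
    then show ?thesis using embedding_nth_H[of \<rho> w] rho_beta_mem rho by simp
  next
    case False
    then show ?thesis using embedding_nth[of \<one> 1 w] beta_pos rho w1 by simp
  qed
  show ?thesis
    using assms(3)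
  proof
    assume "b < \<beta>"
    then show ?thesis
      using assms(2) r by (simp add: slack_def embedding_nth embedding_nth_H)
  next
    assume "a = \<one> \<and> b = \<beta>"
    then show ?thesis
      using r w1 rho rho_beta_mem embedding_nth_H[of \<one> w] embedding_nth_H[of "\<rho> [^] \<beta>" w]
      by (simp add: slack_def)
  qed
qed

text \<open>The slacks with \<open>b < \<beta>\<close> express \<open>x\<close> through its values
  on \<open>H\<close> and at \<open>\<rho>\<close>; the one with \<open>b = \<beta>\<close>
  expresses \<open>x $ \<rho>\<close> through a value on \<open>H\<close>. Hence \<open>x\<close> is
  recovered from its restriction.\<close>

lemma embedding_restriction:
  assumes x: "x \<in> group_cone G"
    and slack: "\<And>a b. a \<in> H \<Longrightarrow> b < \<beta> \<or> a = \<one> \<and> b = \<beta> \<Longrightarrow> slack a b x = 0"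
  shows "\<Phi> (\<Psi> x) = x"
proof (rule vec_eq_iff[THEN iffD2]; rule allI)
  fix g
  show "\<Phi> (\<Psi> x) $ g = x $ g"
  proof (cases "g \<in> carrier G")
    case True
    then obtain a b where ab: "a \<in> H" "b < \<beta>" "g = a \<otimes> \<rho> [^] b" by (rule decompose)
    have "real \<beta> * x $ \<rho> = x $ (\<rho> [^] \<beta>)"
      using slack[of \<one> \<beta>] group_coneD(2)[OF x] rho by (simp add: slack_def)
    then have "x $ \<rho> = \<Psi> x $ (\<rho> [^] \<beta>)"
      using rho_beta_mem beta_pos by (simp add: \<Psi>_def field_simps)
    then show ?thesis
      using slack[of a b] ab beta_pos by (simp add: embedding_nth slack_def \<Psi>_def)
  qed (use group_coneD(1)[OF x] embedding_nth_outside in simp)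
qed

lemma linear_slack: "linear (slack a b)"
  by (rule linearI) (simp_all add: slack_def algebra_simps)

lemma segment_embedding:
  assumes x: "x \<in> group_cone G" and y: "y \<in> group_cone G" and w: "w \<in> group_cone GH"
    and seg: "\<Phi> w \<in> open_segment x y"
  shows "\<Phi> (\<Psi> x) = x \<and> \<Phi> (\<Psi> y) = y"
proof -
  obtain u where u: "0 < u" "u < 1" "\<Phi> w = (1 - u) *\<^sub>R x + u *\<^sub>R y"
    using seg by (auto simp: in_segment)
  have "slack a b x = 0 \<and> slack a b y = 0" if "a \<in> H" "b < \<beta> \<or> a = \<one> \<and> b = \<beta>" for a b
  proof -
    \<comment> \<open>Two non-negative numbers with sum zero both vanish, and the weights
      \<open>u\<close> and \<open>1 - u\<close> are positive.\<close>
    have "(1 - u) * slack a b x + u * slack a b y = 0"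
      using slack_embedding[OF w that] u(3) by (simp add: linear_add linear_scale linear_slack)
    moreover have "0 \<le> (1 - u) * slack a b x" "0 \<le> u * slack a b y"
      using u slack_nonneg[OF x that(1)] slack_nonneg[OF y that(1)] by simp_all
    ultimately have "(1 - u) * slack a b x = 0" "u * slack a b y = 0" by linarith+
    then show ?thesis using u by simp
  qed
  then show ?thesis using embedding_restriction x y by blast
qed

lemma embedding_face_of:
  assumes F: "F face_of group_cone GH"
  shows "\<Phi> ` F face_of group_cone G"
  unfolding face_of_def
proof (intro conjI ballI impI)
  have Fc: "F \<subseteq> group_cone GH" using F by (rule face_of_imp_subset)
  then show "\<Phi> ` F \<subseteq> group_cone G" using embedding_in_cone by blast
  show "convex (\<Phi> ` F)"
    using F face_of_imp_convex linear_embedding convex_linear_image by blast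
  fix x y z assume x: "x \<in> group_cone G" and y: "y \<in> group_cone G"
    and z: "z \<in> \<Phi> ` F" "z \<in> open_segment x y"
  obtain w where w: "w \<in> F" "z = \<Phi> w" using z(1) by blast
  have xy: "\<Phi> (\<Psi> x) = x" "\<Phi> (\<Psi> y) = y"
    using segment_embedding[OF x y] w Fc z(2) by blast+
  moreover have "x \<noteq> y" using z(2) by auto
  \<comment> \<open>An open segment with equal endpoints is empty, so the pulled-back endpoints must
    be shown distinct; they are, since \<open>\<Phi>\<close> maps them back to \<open>x\<close> and
    \<open>y\<close>.\<close>
  ultimately have "\<Psi> x \<noteq> \<Psi> y" by metis
  moreover have "\<exists>u. 0 < u \<and> u < 1 \<and> w = (1 - u) *\<^sub>R \<Psi> x + u *\<^sub>R \<Psi> y"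
  proof -
    obtain u where u: "0 < u" "u < 1" "z = (1 - u) *\<^sub>R x + u *\<^sub>R y"
      using z(2) by (auto simp: in_segment)
    \<comment> \<open>By linearity of \<open>\<Psi>\<close> the same ratio \<open>u\<close> works
      for the pulled-back segment.\<close>
    have "w = \<Psi> z" using restriction_embedding[of w] w Fc by auto
    also have "\<dots> = (1 - u) *\<^sub>R \<Psi> x + u *\<^sub>R \<Psi> y"
      using u(3) by (simp add: linear_add linear_scale linear_restriction)
    finally show ?thesis using u by blast
  qed
  ultimately have "w \<in> open_segment (\<Psi> x) (\<Psi> y)" by (auto simp: in_segment)
  then have "\<Psi> x \<in> F" "\<Psi> y \<in> F"
    using face_ofD[OF F _ _ _ w(1)] restriction_in_cone x y by blast+
  then show "x \<in> \<Phi> ` F" "y \<in> \<Phi> ` F" using xy by (metis imageI)+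
qed

section \<open>The Kunz subgroup of the image\<close>

lemma kunz_subgroup_embedding_iff:
  assumes F: "F \<subseteq> group_cone GH" and ab: "a \<in> H" "b < \<beta>"
  shows "a \<otimes> \<rho> [^] b \<in> kunz_subgroup G (\<Phi> ` F) \<longleftrightarrow>
    a \<in> kunz_subgroup GH F \<and> (b = 0 \<or> \<rho> [^] \<beta> \<in> kunz_subgroup GH F)"
proof -
  \<comment> \<open>The coordinate is a sum of two non-negative terms, with coefficients
    \<open>\<beta> > 0\<close> and \<open>b\<close>, so it vanishes only if both terms do.\<close>
  have "\<Phi> w $ (a \<otimes> \<rho> [^] b) = 0 \<longleftrightarrow> w $ a = 0 \<and> (b = 0 \<or> w $ (\<rho> [^] \<beta>) = 0)"
    if "w \<in> F" for w
  proof -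
    have "0 \<le> w $ g" for g using group_coneD(3) F that by blast
    then show ?thesis
      using ab beta_pos by (auto simp: embedding_nth add_nonneg_eq_0_iff)
  qed
  then show ?thesis
    using ab rho rho_beta_mem by (auto simp: kunz_subgroup_def)
qed

text \<open>Case (i) of the extension: some coordinate at \<open>\<beta>\<rho>\<close> is positive,
  which excludes every exponent except \<open>b = 0\<close>.\<close>

lemma kunz_subgroup_embedding_free:
  assumes F: "F \<subseteq> group_cone GH" and r: "\<rho> [^] \<beta> \<notin> kunz_subgroup GH F"
  shows "kunz_subgroup G (\<Phi> ` F) = kunz_subgroup GH F"
proof (rule Set.set_eqI)
  fix g
  have sub: "kunz_subgroup G (\<Phi> ` F) \<subseteq> carrier G" "kunz_subgroup GH F \<subseteq> H"
    by (auto simp: kunz_subgroup_def)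
  show "g \<in> kunz_subgroup G (\<Phi> ` F) \<longleftrightarrow> g \<in> kunz_subgroup GH F"
  proof
    assume g: "g \<in> kunz_subgroup G (\<Phi> ` F)"
    obtain a b where ab: "a \<in> H" "b < \<beta>" "g = a \<otimes> \<rho> [^] b"
      using decompose g sub by blast
    then show "g \<in> kunz_subgroup GH F"
      using g r kunz_subgroup_embedding_iff[OF F ab(1,2)] by simp
  next
    assume "g \<in> kunz_subgroup GH F"
    then show "g \<in> kunz_subgroup G (\<Phi> ` F)"
      using kunz_subgroup_embedding_iff[OF F, of g 0] beta_pos sub by auto
  qed
qed

lemma subgroup_kunz_subgroup_embedding:
  assumes F: "F \<subseteq> group_cone GH"
  shows "subgroup (kunz_subgroup G (\<Phi> ` F)) G"
  using subgroup_kunz_subgroup embedding_in_cone F by (metis image_subsetI subsetD)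

lemma rho_mem_kunz_subgroup:
  assumes F: "F \<subseteq> group_cone GH" and r: "\<rho> [^] \<beta> \<in> kunz_subgroup GH F"
  shows "\<rho> \<in> kunz_subgroup G (\<Phi> ` F)"
\<comment> \<open>As before, \<open>\<rho>\<close> has decomposition \<open>0 + 1\<rho>\<close> only
  if \<open>\<beta> > 1\<close>; otherwise it is its own \<open>H\<close>-part.\<close>
proof (cases "\<beta> = 1")
  case True
  then have "\<rho> \<in> H" using rho_beta_mem rho by simp
  then show ?thesis
    using kunz_subgroup_embedding_iff[OF F, of \<rho> 0] r True rho by simp
next
  case False
  have "\<one> \<in> kunz_subgroup GH F"
    using subgroup.one_closed[OF GH.subgroup_kunz_subgroup[OF F]] by simp
  then show ?thesis
    using kunz_subgroup_embedding_iff[OF F, of \<one> 1] r False beta_pos rho by simp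
qed

text \<open>Case (ii) of the extension: every exponent is now allowed. The decomposition splits an
  element into parts from the two factors, and conversely both factors lie in the Kunz subgroup of
  the image.\<close>

lemma kunz_subgroup_embedding_torsion:
  assumes F: "F \<subseteq> group_cone GH" and r: "\<rho> [^] \<beta> \<in> kunz_subgroup GH F"
  shows "kunz_subgroup G (\<Phi> ` F) = kunz_subgroup GH F <#> generate G {\<rho>}"
proof
  interpret K: subgroup "kunz_subgroup G (\<Phi> ` F)" G
    by (rule subgroup_kunz_subgroup_embedding[OF F])
  interpret L: subgroup "generate G {\<rho>}" G
    using generate_is_subgroup rho by simp
  have rL: "\<rho> \<in> generate G {\<rho>}" by (rule generate.incl) simp
  show "kunz_subgroup G (\<Phi> ` F) \<subseteq> kunz_subgroup GH F <#> generate G {\<rho>}"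
  proof
    fix g assume g: "g \<in> kunz_subgroup G (\<Phi> ` F)"
    obtain a b where ab: "a \<in> H" "b < \<beta>" "g = a \<otimes> \<rho> [^] b"
      using decompose g K.mem_carrier by blast
    have "a \<in> kunz_subgroup GH F"
      using g ab kunz_subgroup_embedding_iff[OF F ab(1,2)] by simp
    moreover have "\<rho> [^] b \<in> generate G {\<rho>}"
      by (induction b) (use rL in auto)
    ultimately show "g \<in> kunz_subgroup GH F <#> generate G {\<rho>}"
      using ab by (auto simp: set_mult_def)
  qed
  have "kunz_subgroup GH F \<subseteq> kunz_subgroup G (\<Phi> ` F)"
  proof
    fix a assume a: "a \<in> kunz_subgroup GH F"
    then have "a \<in> H" by (simp add: kunz_subgroup_def)
    then show "a \<in> kunz_subgroup G (\<Phi> ` F)"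
      using a kunz_subgroup_embedding_iff[OF F, of a 0] beta_pos by simp
  qed
  moreover have "generate G {\<rho>} \<subseteq> kunz_subgroup G (\<Phi> ` F)"
    using generate_subgroup_incl[OF _ K.subgroup_axioms] rho_mem_kunz_subgroup[OF F r] by simp
  ultimately show "kunz_subgroup GH F <#> generate G {\<rho>} \<subseteq> kunz_subgroup G (\<Phi> ` F)"
    by (auto simp: set_mult_def)
qed

section \<open>The Kunz poset of the image\<close>

lemma embedding_tight_iff:
  assumes w: "w \<in> group_cone GH" and ab: "a \<in> H" "a' \<in> H" "b < \<beta>" "b' < \<beta>"
  shows "\<Phi> w $ (a \<otimes> \<rho> [^] b) + \<Phi> w $ (a' \<otimes> \<rho> [^] b' \<otimes> inv (a \<otimes> \<rho> [^] b))
      = \<Phi> w $ (a' \<otimes> \<rho> [^] b') \<longleftrightarrow>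
    w $ a + w $ (a' \<otimes> inv a) = w $ a' \<and>
    (b \<le> b' \<or> w $ (\<rho> [^] \<beta>) + w $ (a' \<otimes> inv a \<otimes> inv (\<rho> [^] \<beta>)) = w $ (a' \<otimes> inv a))"
proof -
  have aG: "a \<in> carrier G" "a' \<in> carrier G" using ab by auto
  have tri: "w $ (i \<otimes> j) \<le> w $ i + w $ j" if "i \<in> H" "j \<in> H" for i j
    using GH.group_cone_triangle[OF w, of i j] that by simp
  show ?thesis
  proof (cases "b \<le> b'")
    case True
    have "\<rho> [^] b' = \<rho> [^] (b' - b) \<otimes> \<rho> [^] b" using True rho by (simp add: nat_pow_mult)
    then have "a' \<otimes> \<rho> [^] b' \<otimes> inv (a \<otimes> \<rho> [^] b) = (a' \<otimes> inv a) \<otimes> \<rho> [^] (b' - b)"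
      using aG rho by (simp add: mult_inv_cancel_right)
    moreover have "a' \<otimes> inv a \<in> H" "b' - b < \<beta>" using ab by auto
    \<comment> \<open>The multiples of \<open>w $ (\<rho> [^] \<beta>)\<close> cancel, because
      \<open>b + (b' - b) - b' = 0\<close>.\<close>
    ultimately have "\<Phi> w $ (a \<otimes> \<rho> [^] b) + \<Phi> w $ (a' \<otimes> \<rho> [^] b' \<otimes> inv (a \<otimes> \<rho> [^] b))
        - \<Phi> w $ (a' \<otimes> \<rho> [^] b') = real \<beta> * (w $ a + w $ (a' \<otimes> inv a) - w $ a')"
      using ab True by (simp add: embedding_nth of_nat_diff algebra_simps)
    moreover have "real \<beta> \<noteq> 0" using beta_pos by simp
    ultimately show ?thesis
      using True by (metis eq_iff_diff_eq_0 mult_eq_0_iff)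
  next
    case False
    \<comment> \<open>The \<open>H\<close>-part of the difference after borrowing one
      \<open>\<beta>\<rho>\<close>; the exponent becomes \<open>b' + \<beta> - b\<close>, which is
      below \<open>\<beta>\<close> since \<open>b' < b\<close>.\<close>
    define c where "c = a' \<otimes> inv a \<otimes> inv (\<rho> [^] \<beta>)"
    have cH: "c \<in> H" unfolding c_def using ab rho_beta_mem by simp
    have "\<rho> [^] \<beta> \<otimes> \<rho> [^] b' = \<rho> [^] (b' + \<beta> - b) \<otimes> \<rho> [^] b"
      using False ab rho by (simp add: nat_pow_mult add.commute)
    then have "\<rho> [^] b' = inv (\<rho> [^] \<beta>) \<otimes> (\<rho> [^] (b' + \<beta> - b) \<otimes> \<rho> [^] b)"
      using rho by (metis inv_solve_left nat_pow_closed m_closed)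
    then have "\<rho> [^] b' = (inv (\<rho> [^] \<beta>) \<otimes> \<rho> [^] (b' + \<beta> - b)) \<otimes> \<rho> [^] b"
      using rho by (simp add: m_assoc)
    then have "a' \<otimes> \<rho> [^] b' \<otimes> inv (a \<otimes> \<rho> [^] b) = c \<otimes> \<rho> [^] (b' + \<beta> - b)"
      using aG rho mult_inv_cancel_right[of a' a "inv (\<rho> [^] \<beta>) \<otimes> \<rho> [^] (b' + \<beta> - b)" "\<rho> [^] b"]
      by (simp add: c_def m_assoc)
    moreover have "b' + \<beta> - b < \<beta>" using ab False by auto
    \<comment> \<open>Here \<open>b + (b' + \<beta> - b) - b' = \<beta>\<close>, so
      \<open>w $ (\<rho> [^] \<beta>)\<close> survives with the common factor
      \<open>\<beta>\<close>.\<close>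
    ultimately have "\<Phi> w $ (a \<otimes> \<rho> [^] b) + \<Phi> w $ (a' \<otimes> \<rho> [^] b' \<otimes> inv (a \<otimes> \<rho> [^] b))
        - \<Phi> w $ (a' \<otimes> \<rho> [^] b') = real \<beta> * (w $ a + (w $ (\<rho> [^] \<beta>) + w $ c) - w $ a')"
      using ab cH False by (simp add: embedding_nth of_nat_diff algebra_simps)
    moreover have "real \<beta> \<noteq> 0" using beta_pos by simp
    ultimately have "\<Phi> w $ (a \<otimes> \<rho> [^] b) + \<Phi> w $ (a' \<otimes> \<rho> [^] b' \<otimes> inv (a \<otimes> \<rho> [^] b))
        = \<Phi> w $ (a' \<otimes> \<rho> [^] b') \<longleftrightarrow> w $ a + (w $ (\<rho> [^] \<beta>) + w $ c) = w $ a'"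
      by (metis eq_iff_diff_eq_0 mult_eq_0_iff)
    \<comment> \<open>The two triangle inequalities chain from \<open>w $ a'\<close> through
      \<open>w $ a + w $ (a' \<otimes> inv a)\<close> to
      \<open>w $ a + w $ (\<rho> [^] \<beta>) + w $ c\<close>. Equality of the ends forces equality
      in both.\<close>
    moreover have "\<rho> [^] \<beta> \<otimes> c = a' \<otimes> inv a"
      unfolding c_def using aG rho by (simp add: mult_inv_cancel)
    then have "w $ (a' \<otimes> inv a) \<le> w $ (\<rho> [^] \<beta>) + w $ c"
      using tri[OF rho_beta_mem cH] by simp
    moreover have "w $ a' \<le> w $ a + w $ (a' \<otimes> inv a)"
      using tri[of a "a' \<otimes> inv a"] ab aG by (simp add: mult_inv_cancel)
    ultimately show ?thesis
      using False unfolding c_def[symmetric] by linarith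
  qed
qed

lemma kunz_poset_embedding_iff:
  assumes F: "F \<subseteq> group_cone GH" and ab: "a \<in> H" "a' \<in> H" "b < \<beta>" "b' < \<beta>"
  defines "K \<equiv> kunz_subgroup G (\<Phi> ` F)" and "K' \<equiv> kunz_subgroup GH F"
  shows "(K #> (a \<otimes> \<rho> [^] b), K #> (a' \<otimes> \<rho> [^] b')) \<in> snd (kunz_poset G (\<Phi> ` F)) \<longleftrightarrow>
    (K' #> a, K' #> a') \<in> snd (kunz_poset GH F) \<and>
    (b \<le> b' \<or> (K' #> \<rho> [^] \<beta>, K' #> (a' \<otimes> inv a)) \<in> snd (kunz_poset GH F))"
proof -
  have FG: "\<Phi> ` F \<subseteq> group_cone G" using embedding_in_cone F by blast
  have GHiff: "(K' #> c, K' #> d) \<in> snd (kunz_poset GH F)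
      \<longleftrightarrow> (\<forall>w\<in>F. w $ c + w $ (d \<otimes> inv c) = w $ d)" if "c \<in> H" "d \<in> H" for c d
    using GH.kunz_poset_iff[OF F, of c d] that subgroup_H by (simp add: K'_def)
  have "(K #> (a \<otimes> \<rho> [^] b), K #> (a' \<otimes> \<rho> [^] b')) \<in> snd (kunz_poset G (\<Phi> ` F)) \<longleftrightarrow>
    (\<forall>w\<in>F. \<Phi> w $ (a \<otimes> \<rho> [^] b) + \<Phi> w $ (a' \<otimes> \<rho> [^] b' \<otimes> inv (a \<otimes> \<rho> [^] b))
      = \<Phi> w $ (a' \<otimes> \<rho> [^] b'))"
    using kunz_poset_iff[OF FG, of "a \<otimes> \<rho> [^] b" "a' \<otimes> \<rho> [^] b'"] ab rho by (simp add: K_def)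
  also have "\<dots> \<longleftrightarrow> (\<forall>w\<in>F. w $ a + w $ (a' \<otimes> inv a) = w $ a' \<and>
    (b \<le> b' \<or> w $ (\<rho> [^] \<beta>) + w $ (a' \<otimes> inv a \<otimes> inv (\<rho> [^] \<beta>)) = w $ (a' \<otimes> inv a)))"
    using F by (intro ball_cong refl embedding_tight_iff ab) blast
  \<comment> \<open>Since \<open>b \<le> b'\<close> does not involve \<open>w\<close>, the
    quantifier over \<open>F\<close> passes through the disjunction.\<close>
  also have "\<dots> \<longleftrightarrow> (\<forall>w\<in>F. w $ a + w $ (a' \<otimes> inv a) = w $ a') \<and>
    (b \<le> b' \<or> (\<forall>w\<in>F. w $ (\<rho> [^] \<beta>) + w $ (a' \<otimes> inv a \<otimes> inv (\<rho> [^] \<beta>)) = w $ (a' \<otimes> inv a)))"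
    by blast
  finally show ?thesis
    unfolding GHiff[OF ab(1,2)] GHiff[OF rho_beta_mem H.m_closed[OF ab(2) H.m_inv_closed[OF ab(1)]]] .
qed

lemma kunz_poset_embedding_free:
  assumes F: "F \<subseteq> group_cone GH" and r: "\<rho> [^] \<beta> \<notin> kunz_subgroup GH F"
  shows "kunz_poset G (\<Phi> ` F) =
    augmented_monoscopic_extension G H (kunz_subgroup GH F) \<rho> (kunz_poset GH F)"
proof -
  define K' where "K' = kunz_subgroup GH F"
  have K: "kunz_subgroup G (\<Phi> ` F) = K'"
    using kunz_subgroup_embedding_free[OF F r] by (simp add: K'_def)
  have "subgroup K' G"
    using subgroup_kunz_subgroup_embedding[OF F] by (simp add: K)
  then interpret K': normal K' G by (rule subgroup_imp_normal)
  \<comment> \<open>The extension forms products in \<open>G Mod K'\<close> but differences in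
    \<open>GH Mod K'\<close>, so \<open>K'\<close> is needed as a normal subgroup of both
    groups.\<close>
  have "subgroup K' GH" unfolding K'_def by (rule GH.subgroup_kunz_subgroup[OF F])
  then interpret K'H: normal K' GH by (rule GH.subgroup_imp_normal)
  define R where "R = {(A \<otimes>\<^bsub>G Mod K'\<^esub> (K' #> \<rho>) [^]\<^bsub>G Mod K'\<^esub> b,
        A' \<otimes>\<^bsub>G Mod K'\<^esub> (K' #> \<rho>) [^]\<^bsub>G Mod K'\<^esub> b') | A A' b b'.
      A \<in> carrier (GH Mod K') \<and> A' \<in> carrier (GH Mod K') \<and> b < \<beta> \<and> b' < \<beta> \<and>
      (A, A') \<in> snd (kunz_poset GH F) \<and>
      (b \<le> b' \<or> ((K' #> \<rho>) [^]\<^bsub>G Mod K'\<^esub> \<beta>, A' \<otimes>\<^bsub>GH Mod K'\<^esub> inv\<^bsub>GH Mod K'\<^esub> A)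
        \<in> snd (kunz_poset GH F))}"
  \<comment> \<open>Products, powers and differences of cosets are rewritten on representatives,
    where the criterion for the image's poset applies.\<close>
  have pow: "(K' #> \<rho>) [^]\<^bsub>G Mod K'\<^esub> (n::nat) = K' #> \<rho> [^] n" for n
    by (rule K'.FactGroup_pow[OF rho])
  have mult: "(K' #> a) \<otimes>\<^bsub>G Mod K'\<^esub> (K' #> \<rho>) [^]\<^bsub>G Mod K'\<^esub> (n::nat) = K' #> (a \<otimes> \<rho> [^] n)"
    if "a \<in> H" for a n
    using that rho by (simp add: pow K'.rcos_sum)
  have diff: "(K' #> a') \<otimes>\<^bsub>GH Mod K'\<^esub> inv\<^bsub>GH Mod K'\<^esub> (K' #> a) = K' #> (a' \<otimes> inv a)"
    if "a \<in> H" "a' \<in> H" for a a'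
  proof -
    have "K' #> a \<in> carrier (GH Mod K')"
      using that by (auto simp: carrier_FactGroup)
    then have "inv\<^bsub>GH Mod K'\<^esub> (K' #> a) = K' #> inv a"
      using K'H.inv_FactGroup K'H.rcos_inv[of a] that subgroup_H by simp
    then show ?thesis
      using K'H.rcos_sum[of a' "inv a"] that by simp
  qed
  have coset: "A \<in> carrier (GH Mod K') \<longleftrightarrow> (\<exists>a\<in>H. A = K' #> a)" for A
    by (auto simp: carrier_FactGroup)
  \<comment> \<open>This selects the first branch of the extension.\<close>
  have "(K' #> \<rho>) [^]\<^bsub>G Mod K'\<^esub> \<beta> \<noteq> K'"
    using r coset_join1[of K' "\<rho> [^] \<beta>"] K'.subset K'.subgroup_axioms rho
    by (auto simp: pow K'_def[symmetric])
  then have aug: "augmented_monoscopic_extension G H K' \<rho> (kunz_poset GH F) = (carrier (G Mod K'), R)"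
    by (simp add: augmented_monoscopic_extension_def R_def Let_def)
  have iff: "(K' #> (a \<otimes> \<rho> [^] b), K' #> (a' \<otimes> \<rho> [^] b')) \<in> snd (kunz_poset G (\<Phi> ` F)) \<longleftrightarrow>
    (K' #> a, K' #> a') \<in> snd (kunz_poset GH F) \<and>
    (b \<le> b' \<or> (K' #> \<rho> [^] \<beta>, K' #> (a' \<otimes> inv a)) \<in> snd (kunz_poset GH F))"
    if "a \<in> H" "a' \<in> H" "b < \<beta>" "b' < \<beta>" for a a' b b'
    using kunz_poset_embedding_iff[OF F that] by (simp add: K flip: K'_def)
  have "snd (kunz_poset G (\<Phi> ` F)) = R"
  proof (rule Set.set_eqI, rule iffI)
    fix p assume p: "p \<in> snd (kunz_poset G (\<Phi> ` F))"
    then obtain g g' where g: "g \<in> carrier G" "g' \<in> carrier G" "p = (K' #> g, K' #> g')"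
      by (rule kunz_poset_cases) (auto simp: K)
    obtain a b where ab: "a \<in> H" "b < \<beta>" "g = a \<otimes> \<rho> [^] b" using decompose[OF g(1)] .
    obtain a' b' where ab': "a' \<in> H" "b' < \<beta>" "g' = a' \<otimes> \<rho> [^] b'" using decompose[OF g(2)] .
    have "p = ((K' #> a) \<otimes>\<^bsub>G Mod K'\<^esub> (K' #> \<rho>) [^]\<^bsub>G Mod K'\<^esub> b,
        (K' #> a') \<otimes>\<^bsub>G Mod K'\<^esub> (K' #> \<rho>) [^]\<^bsub>G Mod K'\<^esub> b')"
      by (simp only: mult ab(1) ab'(1) g(3) ab(3) ab'(3))
    moreover have "(K' #> a, K' #> a') \<in> snd (kunz_poset GH F) \<and>
      (b \<le> b' \<or> (K' #> \<rho> [^] \<beta>, K' #> (a' \<otimes> inv a)) \<in> snd (kunz_poset GH F))"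
      using p iff[OF ab(1) ab'(1) ab(2) ab'(2)] g ab ab' by simp
    then have "(K' #> a, K' #> a') \<in> snd (kunz_poset GH F)"
      and "b \<le> b' \<or> ((K' #> \<rho>) [^]\<^bsub>G Mod K'\<^esub> \<beta>, (K' #> a') \<otimes>\<^bsub>GH Mod K'\<^esub> inv\<^bsub>GH Mod K'\<^esub> (K' #> a))
        \<in> snd (kunz_poset GH F)"
      by (simp_all only: pow diff ab(1) ab'(1))
    moreover have "K' #> a \<in> carrier (GH Mod K')" "K' #> a' \<in> carrier (GH Mod K')"
      using ab(1) ab'(1) coset by blast+
    ultimately show "p \<in> R"
      unfolding R_def using ab(2) ab'(2) by blast
  next
    fix p assume "p \<in> R"
    then obtain a a' b b' where "a \<in> H" "a' \<in> H" "b < \<beta>" "b' < \<beta>"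
      and "p = ((K' #> a) \<otimes>\<^bsub>G Mod K'\<^esub> (K' #> \<rho>) [^]\<^bsub>G Mod K'\<^esub> b,
        (K' #> a') \<otimes>\<^bsub>G Mod K'\<^esub> (K' #> \<rho>) [^]\<^bsub>G Mod K'\<^esub> b')"
      and "(K' #> a, K' #> a') \<in> snd (kunz_poset GH F)"
      and "b \<le> b' \<or> ((K' #> \<rho>) [^]\<^bsub>G Mod K'\<^esub> \<beta>, (K' #> a') \<otimes>\<^bsub>GH Mod K'\<^esub> inv\<^bsub>GH Mod K'\<^esub> (K' #> a))
        \<in> snd (kunz_poset GH F)"
      unfolding R_def coset by blast
    then show "p \<in> snd (kunz_poset G (\<Phi> ` F))"
      by (simp only: mult diff pow[of \<beta>] iff simp_thms)
  qed
  then show ?thesis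
    by (simp add: aug fst_kunz_poset K prod_eq_iff flip: K'_def)
qed

lemma kunz_poset_embedding_torsion:
  assumes F: "F \<subseteq> group_cone GH" and r: "\<rho> [^] \<beta> \<in> kunz_subgroup GH F"
  shows "kunz_poset G (\<Phi> ` F) =
    augmented_monoscopic_extension G H (kunz_subgroup GH F) \<rho> (kunz_poset GH F)"
proof -
  define K' where "K' = kunz_subgroup GH F"
  define K where "K = kunz_subgroup G (\<Phi> ` F)"
  have N: "K' <#> generate G {\<rho>} = K"
    using kunz_subgroup_embedding_torsion[OF F r] by (simp add: K_def K'_def)
  have sK: "subgroup K G"
    unfolding K_def by (rule subgroup_kunz_subgroup_embedding[OF F])
  interpret K: subgroup K G by (rule sK)
  have sK': "subgroup K' GH" unfolding K'_def by (rule GH.subgroup_kunz_subgroup[OF F])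
  then have sK'G: "subgroup K' G"
    using incl_subgroup[OF subgroup_H] by blast
  interpret K': normal K' G by (rule subgroup_imp_normal[OF sK'G])
  have rK: "\<rho> \<in> K" unfolding K_def by (rule rho_mem_kunz_subgroup[OF F r])
  have K'K: "K' \<subseteq> K"
  proof
    fix a assume a: "a \<in> K'"
    then have "a \<otimes> \<one> \<in> K' <#> generate G {\<rho>}"
      unfolding set_mult_def using generate.one[of G "{\<rho>}"] by blast
    then show "a \<in> K" using a N by simp
  qed
  \<comment> \<open>The natural map from \<open>H/K'\<close> to \<open>G/K\<close>, computed on
    representatives.\<close>
  have absorb: "K <#> (K' #> a) = K #> a" if a: "a \<in> carrier G" for a
  proof -
    have "K <#> K' = K"
      by (rule set_mult_subgroup_idem[OF sK subgroup_incl[OF sK'G sK K'K]])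
    then show ?thesis
      using setmult_rcos_assoc[OF K.subset K'.subset a] by simp
  qed
  \<comment> \<open>As \<open>\<rho>\<close> lies in \<open>K\<close>, the \<open>H\<close>-part of
    an element represents the same coset of \<open>K\<close>.\<close>
  have coset: "K #> (a \<otimes> \<rho> [^] b) = K #> a" if a: "a \<in> H" for a and b :: nat
  proof -
    have "\<rho> [^] b \<in> K" by (induction b) (use rK in auto)
    then have "K #> \<rho> [^] b = K" using coset_join2[OF _ sK] by simp
    then have "K #> (\<rho> [^] b \<otimes> a) = K #> a"
      using coset_mult_assoc[OF K.subset, of "\<rho> [^] b" a] a rho by simp
    then show ?thesis using a rho by (simp add: m_comm)
  qed
  \<comment> \<open>With both exponents zero, \<open>b \<le> b'\<close> holds and only the condition
    on the \<open>H\<close>-parts remains.\<close>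
  have iff: "(K #> a, K #> a') \<in> snd (kunz_poset G (\<Phi> ` F)) \<longleftrightarrow>
    (K' #> a, K' #> a') \<in> snd (kunz_poset GH F)" if "a \<in> H" "a' \<in> H" for a a'
    using kunz_poset_embedding_iff[OF F that, of 0 0] that beta_pos by (simp flip: K_def K'_def)
  \<comment> \<open>This selects the second branch of the extension.\<close>
  have "(K' #> \<rho>) [^]\<^bsub>G Mod K'\<^esub> \<beta> = K'"
    using coset_join2[OF _ sK'G] r rho by (simp add: K'.FactGroup_pow flip: K'_def)
  then have aug: "augmented_monoscopic_extension G H K' \<rho> (kunz_poset GH F) =
      (carrier (G Mod K), {(K <#> A, K <#> A') | A A'. (A, A') \<in> snd (kunz_poset GH F)})"
    by (simp add: augmented_monoscopic_extension_def N Let_def)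
  have "snd (kunz_poset G (\<Phi> ` F)) = {(K <#> A, K <#> A') | A A'. (A, A') \<in> snd (kunz_poset GH F)}"
  proof (rule Set.set_eqI, rule iffI)
    fix p assume p: "p \<in> snd (kunz_poset G (\<Phi> ` F))"
    then obtain g g' where g: "g \<in> carrier G" "g' \<in> carrier G" "p = (K #> g, K #> g')"
      by (rule kunz_poset_cases) (auto simp: K_def)
    obtain a b where ab: "a \<in> H" "b < \<beta>" "g = a \<otimes> \<rho> [^] b" using decompose[OF g(1)] .
    obtain a' b' where ab': "a' \<in> H" "b' < \<beta>" "g' = a' \<otimes> \<rho> [^] b'" using decompose[OF g(2)] .
    have p': "p = (K #> a, K #> a')" using g ab ab' by (simp add: coset)
    then have "(K' #> a, K' #> a') \<in> snd (kunz_poset GH F)"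
      using p iff ab ab' by simp
    moreover have "p = (K <#> (K' #> a), K <#> (K' #> a'))"
      using p' ab ab' by (simp add: absorb)
    ultimately show "p \<in> {(K <#> A, K <#> A') | A A'. (A, A') \<in> snd (kunz_poset GH F)}"
      by blast
  next
    fix p assume "p \<in> {(K <#> A, K <#> A') | A A'. (A, A') \<in> snd (kunz_poset GH F)}"
    then obtain A A' where AA': "(A, A') \<in> snd (kunz_poset GH F)" "p = (K <#> A, K <#> A')"
      by blast
    obtain a a' where a: "a \<in> H" "a' \<in> H" "A = K' #> a" "A' = K' #> a'"
      by (rule kunz_poset_cases[OF AA'(1)]) (auto simp flip: K'_def)
    then show "p \<in> snd (kunz_poset G (\<Phi> ` F))"
      using AA' iff by (simp add: absorb)
  qed
  then show ?thesis
    by (simp add: aug fst_kunz_poset prod_eq_iff flip: K'_def K_def)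
qed

lemma kunz_poset_embedding:
  assumes "F \<subseteq> group_cone GH"
  shows "kunz_poset G (\<Phi> ` F) =
    augmented_monoscopic_extension G H (kunz_subgroup GH F) \<rho> (kunz_poset GH F)"
  using kunz_poset_embedding_free[OF assms] kunz_poset_embedding_torsion[OF assms] by blast

end

theorem theorem6p7:
  fixes G :: "('a::finite, 'm) monoid_scheme" and H :: "'a set" and \<rho> :: 'a
  assumes "comm_group G"
    and "subgroup H G"
    and "cyclic_group (G Mod H)"
    and "\<rho> \<in> carrier G"
    and "subgroup_generated (G Mod H) {H #>\<^bsub>G\<^esub> \<rho>} = G Mod H"
  shows "monoscopic_embedding G H \<rho> ` group_cone (G\<lparr>carrier := H\<rparr>) face_of group_cone G \<and>
    (\<forall>F. F face_of group_cone (G\<lparr>carrier := H\<rparr>) \<longrightarrow>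
       monoscopic_embedding G H \<rho> ` F face_of group_cone G \<and>
       kunz_poset G (monoscopic_embedding G H \<rho> ` F) =
         augmented_monoscopic_extension G H (kunz_subgroup (G\<lparr>carrier := H\<rparr>) F) \<rho>
           (kunz_poset (G\<lparr>carrier := H\<rparr>) F))"
proof -
  \<comment> \<open>\<open>subgroup_generated\<close> first intersects the generating set with the
    carrier, so membership of the coset is needed to read off what it generates.\<close>
  have "H #>\<^bsub>G\<^esub> \<rho> \<in> carrier (G Mod H)"
    using assms(4) by (auto simp: carrier_FactGroup)
  then have "generate (G Mod H) {H #>\<^bsub>G\<^esub> \<rho>} = carrier (G Mod H)"
    using arg_cong[OF assms(5), of carrier] by (simp add: carrier_subgroup_generated)
  then interpret monoscopic G H \<rho>
    using assms by (simp add: monoscopic_def monoscopic_axioms_def cone_group_def)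
  have "group_cone (G\<lparr>carrier := H\<rparr>) face_of group_cone (G\<lparr>carrier := H\<rparr>)"
    using GH.convex_group_cone by (rule face_of_refl)
  then show ?thesis
    using embedding_face_of kunz_poset_embedding face_of_imp_subset by blast
qed

end
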